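(* Let $C_n$ be a signed cycle with vertices $v_1,\dots,v_n$ in cyclic order, and let $T_{m_1},T_{m_2}$ be vertex-disjoint signed trees with $m_1,m_2$ vertices. Let $U=U(C_n,T_{m_1},T_{m_2},l)$ be the signed unicyclic graph obtained by joining the root of $T_{m_1}$ by an edge to $v_1$ and the root of $T_{m_2}$ by an edge to $v_{l+1}$, where $v_1$ and $v_{l+1}$ are at distance $l\ge1$ on the cycle. Then $$\det U=\det\big(U(C_n,T_{m_2})\big)\det(T_{m_1})+\det(\{T_{m_1},v_1\})\det(\{T_{m_2},v_{l+1}\})\det(P_{l-1})\det(P_{n-l-1})+\det(\{T_{m_1},v_1\})\det(T_{m_2})\det(P_{n-1}).$$
   Context: A signed graph has edge weights in $\{1,-1\}$ and its determinant is that of its adjacency matrix; the determinant of the empty graph is $1$. $U(C_n,T_{m_2})$ is the subgraph of $U$ obtained by deleting $T_{m_1}$. $\{T,w\}$ denotes the subgraph induced by the vertices of tree $T$ together with vertex $w$. $P_{n-1}$ is the signed path $C_n\setminus v_1$; $P_{l-1}$ and $P_{n-l-1}$ are the two signed paths forming $C_n\setminus\{v_1,v_{l+1}\}$ (on $l-1$ and $n-l-1$ vertices). *)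

theory Defs
  imports
    "Jordan_Normal_Form.Determinant"
    "HOL-Combinatorics.Permutations"
begin

text \<open>
  Edges are two-element vertex sets. The weight function is total on sets; only its values on
  edges are meaningful.
\<close>

record 'a sgraph =
  verts :: "'a set"
  edges :: "'a set set"
  weight :: "'a set \<Rightarrow> int"

definition signed_graph :: "'a sgraph \<Rightarrow> bool" where
  "signed_graph G \<longleftrightarrow>
     finite (verts G) \<and>
     (\<forall>e\<in>edges G. e \<subseteq> verts G \<and> card e = 2 \<and> weight G e \<in> {1, -1})"

definition adj :: "'a sgraph \<Rightarrow> 'a \<Rightarrow> 'a \<Rightarrow> int" where
  "adj G u w = (if {u, w} \<in> edges G then weight G {u, w} else 0)"

definition adj_mat :: "'a sgraph \<Rightarrow> 'a list \<Rightarrow> int mat" where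
  "adj_mat G xs = mat (length xs) (length xs) (\<lambda>(i, j). adj G (xs ! i) (xs ! j))"

text \<open>
  The enumeration of the vertices is immaterial, see \<open>graph_det_eq\<close> below.
\<close>

definition graph_det :: "'a sgraph \<Rightarrow> int" where
  "graph_det G = det (adj_mat G (SOME xs. distinct xs \<and> set xs = verts G))"

lemma det_adj_mat_enumeration:
  assumes "distinct xs" "distinct ys" "set xs = set ys"
  shows "det (adj_mat G xs) = det (adj_mat G ys)"
proof -
  have "mset ys = mset xs"
    using assms by (simp add: set_eq_iff_mset_eq_distinct)
  then obtain p where p: "p permutes {..<length xs}" and ys: "permute_list p xs = ys"
    by (rule mset_eq_permutation)
  define n where "n = length xs"
  have p': "p permutes {0..<n}"
    using p by (simp add: n_def atLeast0LessThan)
  have pn: "p i < n" if "i < n" for i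
    using permutes_in_image[OF p', of i] that by simp
  define A where "A = adj_mat G xs"
  have A: "A \<in> carrier_mat n n"
    by (simp add: A_def adj_mat_def n_def)
  define B where "B = mat n n (\<lambda>(i, j). A $$ (p i, j))"
  have B: "B \<in> carrier_mat n n"
    by (simp add: B_def)
  have BT: "transpose_mat B \<in> carrier_mat n n"
    using B by simp
  define D where "D = mat n n (\<lambda>(i, j). transpose_mat B $$ (p i, j))"
  have "D = transpose_mat (adj_mat G ys)"
  proof (rule eq_matI)
    fix i j
    assume "i < dim_row (transpose_mat (adj_mat G ys))"
      and "j < dim_col (transpose_mat (adj_mat G ys))"
    then have ij: "i < n" "j < n"
      by (auto simp: adj_mat_def n_def simp flip: ys)
    have nth: "ys ! k = xs ! p k" if "k < n" for k
      using permute_list_nth[OF p] that by (simp add: n_def flip: ys)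
    have "length ys = n"
      by (simp add: n_def flip: ys)
    then show "D $$ (i, j) = transpose_mat (adj_mat G ys) $$ (i, j)"
      using ij pn nth by (simp add: D_def B_def A_def adj_mat_def flip: n_def)
  qed (auto simp: D_def adj_mat_def n_def simp flip: ys)
  moreover have "det D = signof p * det B"
    unfolding D_def using det_permute_rows[OF BT p'] det_transpose[OF B] by simp
  moreover have "det B = signof p * det A"
    unfolding B_def by (rule det_permute_rows[OF A p'])
  moreover have "det (transpose_mat (adj_mat G ys)) = det (adj_mat G ys)"
    by (rule det_transpose[of _ "length ys"]) (simp add: adj_mat_def)
  moreover have "signof p * (signof p * det A) = det A"
    by (simp add: sign_def)
  ultimately show ?thesis
    by (simp add: A_def)
qed

lemma graph_det_eq:
  assumes "distinct xs" "set xs = verts G"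
  shows "graph_det G = det (adj_mat G xs)"
proof -
  have "distinct (SOME xs. distinct xs \<and> set xs = verts G) \<and>
        set (SOME xs. distinct xs \<and> set xs = verts G) = verts G"
    by (rule someI[of _ xs]) (simp add: assms)
  then show ?thesis
    unfolding graph_det_def using assms by (intro det_adj_mat_enumeration) auto
qed

lemma graph_det_empty: "verts G = {} \<Longrightarrow> graph_det G = 1"
  by (subst graph_det_eq[of "[]"]) (auto simp: adj_mat_def)

definition induced :: "'a sgraph \<Rightarrow> 'a set \<Rightarrow> 'a sgraph" where
  "induced G S = G\<lparr>verts := verts G \<inter> S, edges := {e \<in> edges G. e \<subseteq> S}\<rparr>"

definition delete :: "'a sgraph \<Rightarrow> 'a set \<Rightarrow> 'a sgraph" where
  "delete G S = induced G (verts G - S)"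

definition walk :: "'a sgraph \<Rightarrow> 'a \<Rightarrow> 'a list \<Rightarrow> 'a \<Rightarrow> bool" where
  "walk G u xs w \<longleftrightarrow>
     xs \<noteq> [] \<and> hd xs = u \<and> last xs = w \<and> set xs \<subseteq> verts G \<and>
     (\<forall>i. Suc i < length xs \<longrightarrow> {xs ! i, xs ! Suc i} \<in> edges G)"

definition connected_graph :: "'a sgraph \<Rightarrow> bool" where
  "connected_graph G \<longleftrightarrow>
     verts G \<noteq> {} \<and> (\<forall>u\<in>verts G. \<forall>w\<in>verts G. \<exists>xs. walk G u xs w)"

text \<open>Only used for vertices of the same component.\<close>

definition graph_dist :: "'a sgraph \<Rightarrow> 'a \<Rightarrow> 'a \<Rightarrow> nat" where
  "graph_dist G u w = (LEAST k. \<exists>xs. walk G u xs w \<and> length xs = Suc k)"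

definition has_cycle :: "'a sgraph \<Rightarrow> bool" where
  "has_cycle G \<longleftrightarrow>
     (\<exists>xs. length xs \<ge> 3 \<and> distinct xs \<and> walk G (hd xs) xs (last xs) \<and>
       {last xs, hd xs} \<in> edges G)"

definition signed_tree :: "'a sgraph \<Rightarrow> bool" where
  "signed_tree T \<longleftrightarrow> signed_graph T \<and> connected_graph T \<and> \<not> has_cycle T"

definition signed_cycle :: "'a sgraph \<Rightarrow> nat \<Rightarrow> (nat \<Rightarrow> 'a) \<Rightarrow> bool" where
  "signed_cycle C n v \<longleftrightarrow>
     signed_graph C \<and> n \<ge> 3 \<and> inj_on v {1..n} \<and> verts C = v ` {1..n} \<and>
     edges C = {{v i, v (i + 1)} | i. 1 \<le> i \<and> i < n} \<union> {{v n, v 1}}"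

text \<open>Intended for vertex-disjoint \<open>G\<close> and \<open>H\<close>.\<close>

definition join_edge :: "'a sgraph \<Rightarrow> 'a \<Rightarrow> 'a sgraph \<Rightarrow> 'a \<Rightarrow> int \<Rightarrow> 'a sgraph" where
  "join_edge G u H w s =
     \<lparr>verts = verts G \<union> verts H,
      edges = edges G \<union> edges H \<union> {{u, w}},
      weight = (\<lambda>e. if e = {u, w} then s else if e \<in> edges G then weight G e else weight H e)\<rparr>"

lemma signed_graph_join_edge:
  assumes "signed_graph G" "signed_graph H" "verts G \<inter> verts H = {}"
    and "u \<in> verts G" "w \<in> verts H" "s \<in> {1, -1}"
  shows "signed_graph (join_edge G u H w s)"
proof -
  have "u \<noteq> w" using assms by auto
  then show ?thesis using assms by (auto simp: signed_graph_def join_edge_def)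
qed

text \<open>
  \<open>s1\<close> and \<open>s2\<close> are the weights of the edges joining the roots \<open>r1\<close> and \<open>r2\<close> to the cycle.
\<close>

definition unicyclic ::
  "'a sgraph \<Rightarrow> (nat \<Rightarrow> 'a) \<Rightarrow> nat \<Rightarrow> 'a sgraph \<Rightarrow> 'a \<Rightarrow> int \<Rightarrow> 'a sgraph \<Rightarrow> 'a \<Rightarrow> int \<Rightarrow> 'a sgraph"
  where
  "unicyclic C v l T1 r1 s1 T2 r2 s2 =
     join_edge (join_edge C (v (l + 1)) T2 r2 s2) (v 1) T1 r1 s1"

end

theory Submission
  imports Defs
begin

text \<open>
  Let \<open>z\<close> be a cut vertex separating the vertex sets \<open>A\<close> and \<open>B\<close>. Splitting the row of \<open>z\<close> in the
  adjacency matrix into its \<open>A\<close>-part and its \<open>B\<close>-part writes the determinant as a sum of two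
  block triangular ones, whence \<open>det (A z B) = det (A z) * det B + det A * det (z B)\<close>.
  An end of a bridge is a cut vertex: using this at \<open>v 1\<close>, and then at \<open>v (l + 1)\<close> in what remains
  after deleting \<open>v 1\<close> and \<open>T1\<close>, gives the formula for \<open>U\<close>.
\<close>

definition list_mat :: "('a \<Rightarrow> 'a \<Rightarrow> 'b) \<Rightarrow> 'a list \<Rightarrow> 'b mat" where
  "list_mat f xs = mat (length xs) (length xs) (\<lambda>(i, j). f (xs ! i) (xs ! j))"

lemma list_mat_carrier [simp]: "list_mat f xs \<in> carrier_mat (length xs) (length xs)"
  by (simp add: list_mat_def)

lemma list_mat_cong:
  assumes "\<And>x y. x \<in> set xs \<Longrightarrow> y \<in> set xs \<Longrightarrow> f x y = g x y"
  shows "list_mat f xs = list_mat g xs"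
  unfolding list_mat_def by (rule cong_mat) (auto intro: assms)

lemma list_mat_append:
  "list_mat f (xs @ ys) =
     four_block_mat (list_mat f xs)
       (mat (length xs) (length ys) (\<lambda>(i, j). f (xs ! i) (ys ! j)))
       (mat (length ys) (length xs) (\<lambda>(i, j). f (ys ! i) (xs ! j)))
       (list_mat f ys)"
  by (rule eq_matI) (auto simp: list_mat_def four_block_mat_def Let_def nth_append)

lemma det_list_mat_append_upper_zero:
  fixes f :: "'a \<Rightarrow> 'a \<Rightarrow> 'b :: idom"
  assumes "\<And>x y. x \<in> set xs \<Longrightarrow> y \<in> set ys \<Longrightarrow> f x y = 0"
  shows "det (list_mat f (xs @ ys)) = det (list_mat f xs) * det (list_mat f ys)"
proof -
  have "mat (length xs) (length ys) (\<lambda>(i, j). f (xs ! i) (ys ! j)) = 0\<^sub>m (length xs) (length ys)"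
    by (rule eq_matI) (auto intro: assms)
  then show ?thesis
    unfolding list_mat_append by (intro det_four_block_mat_upper_right_zero) auto
qed

lemma det_list_mat_append_lower_zero:
  fixes f :: "'a \<Rightarrow> 'a \<Rightarrow> 'b :: idom"
  assumes "\<And>x y. x \<in> set xs \<Longrightarrow> y \<in> set ys \<Longrightarrow> f y x = 0"
  shows "det (list_mat f (xs @ ys)) = det (list_mat f xs) * det (list_mat f ys)"
proof -
  have "mat (length ys) (length xs) (\<lambda>(i, j). f (ys ! i) (xs ! j)) = 0\<^sub>m (length ys) (length xs)"
    by (rule eq_matI) (auto intro: assms)
  then show ?thesis
    unfolding list_mat_append by (intro det_four_block_mat_lower_left_zero) auto
qed

lemma list_mat_fun_upd:
  assumes "distinct xs" "k < length xs"
  shows "list_mat (f(xs ! k := g)) xs =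
    mat\<^sub>r (length xs) (length xs)
      (\<lambda>i. if i = k then vec (length xs) (\<lambda>j. g (xs ! j))
           else vec (length xs) (\<lambda>j. f (xs ! i) (xs ! j)))"
  by (rule eq_matI) (use assms in \<open>auto simp: list_mat_def nth_eq_iff_index_eq\<close>)

lemma det_list_mat_row_add:
  fixes f :: "'a \<Rightarrow> 'a \<Rightarrow> 'b :: comm_ring_1"
  assumes "distinct xs" "z \<in> set xs"
  shows "det (list_mat (f(z := \<lambda>y. g y + h y)) xs) =
    det (list_mat (f(z := g)) xs) + det (list_mat (f(z := h)) xs)"
proof -
  define row where "row r = vec (length xs) (\<lambda>j. r (xs ! j))" for r :: "'a \<Rightarrow> 'b"
  obtain k where k: "k < length xs" "z = xs ! k"
    using assms(2) by (auto simp: in_set_conv_nth)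
  have "vec (length xs) (\<lambda>j. g (xs ! j) + h (xs ! j)) = row g + row h"
    by (auto simp: row_def)
  moreover have "row r \<in> carrier_vec (length xs)" for r
    by (simp add: row_def)
  ultimately show ?thesis
    unfolding k(2) list_mat_fun_upd[OF assms(1) k(1)] row_def[symmetric]
    using det_row_add[of "\<lambda>_. row g" k "length xs" "\<lambda>_. row h" "\<lambda>i. row (f (xs ! i))"] k(1)
    by (simp cong: if_cong)
qed

lemma det_list_mat_split_row:
  fixes f :: "'a \<Rightarrow> 'a \<Rightarrow> 'b :: idom"
  assumes distinct: "distinct (xs @ z # ys)"
    and upper_zero: "\<And>x y. x \<in> set xs \<Longrightarrow> y \<in> set ys \<Longrightarrow> f x y = 0"
    and lower_zero: "\<And>x y. x \<in> set xs \<Longrightarrow> y \<in> set ys \<Longrightarrow> f y x = 0"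
  shows "det (list_mat f (xs @ z # ys)) =
    det (list_mat f (xs @ [z])) * det (list_mat f ys) +
    det (list_mat f xs) *
      det (list_mat (f(z := \<lambda>y. if y \<in> set ys then f z y else 0)) (z # ys))"
proof -
  define left_row where "left_row = (\<lambda>y. if y \<in> set ys then 0 else f z y)"
  define right_row where "right_row = (\<lambda>y. if y \<in> set ys then f z y else 0)"
  define f_left where "f_left = f(z := left_row)"
  define f_right where "f_right = f(z := right_row)"
  have "f(z := \<lambda>y. left_row y + right_row y) = f"
    by (auto simp: left_row_def right_row_def fun_eq_iff)
  then have "det (list_mat f (xs @ z # ys)) =
      det (list_mat f_left ((xs @ [z]) @ ys)) + det (list_mat f_right (xs @ z # ys))"
    using det_list_mat_row_add[OF distinct, of z f left_row right_row]
    by (simp add: f_left_def f_right_def)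
  also have "det (list_mat f_left ((xs @ [z]) @ ys)) =
      det (list_mat f_left (xs @ [z])) * det (list_mat f_left ys)"
    using distinct
    by (intro det_list_mat_append_upper_zero) (auto simp: f_left_def left_row_def upper_zero)
  also have "list_mat f_left (xs @ [z]) = list_mat f (xs @ [z])"
    using distinct by (intro list_mat_cong) (auto simp: f_left_def left_row_def)
  also have "list_mat f_left ys = list_mat f ys"
    using distinct by (intro list_mat_cong) (auto simp: f_left_def left_row_def)
  also have "det (list_mat f_right (xs @ z # ys)) =
      det (list_mat f_right xs) * det (list_mat f_right (z # ys))"
    using distinct
    by (intro det_list_mat_append_lower_zero) (auto simp: f_right_def right_row_def lower_zero)
  also have "list_mat f_right xs = list_mat f xs"
    using distinct by (intro list_mat_cong) (auto simp: f_right_def right_row_def)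
  finally show ?thesis
    unfolding f_right_def right_row_def .
qed

lemma det_list_mat_cut_vertex:
  fixes f :: "'a \<Rightarrow> 'a \<Rightarrow> 'b :: idom"
  assumes "distinct (xs @ z # ys)"
    and "\<And>x y. x \<in> set xs \<Longrightarrow> y \<in> set ys \<Longrightarrow> f x y = 0"
    and "\<And>x y. x \<in> set xs \<Longrightarrow> y \<in> set ys \<Longrightarrow> f y x = 0"
  shows "det (list_mat f (xs @ z # ys)) =
    det (list_mat f (xs @ [z])) * det (list_mat f ys) +
    det (list_mat f xs) * det (list_mat f (z # ys)) -
    f z z * det (list_mat f xs) * det (list_mat f ys)"
proof -
  have "det (list_mat f (z # ys)) = f z z * det (list_mat f ys) +
      det (list_mat (f(z := \<lambda>y. if y \<in> set ys then f z y else 0)) (z # ys))"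
    using det_list_mat_split_row[of "[]" z ys f] assms(1) by (simp add: list_mat_def det_single)
  then show ?thesis
    using det_list_mat_split_row[OF assms] by (simp add: algebra_simps)
qed

lemma adj_mat_eq_list_mat: "adj_mat G xs = list_mat (adj G) xs"
  by (simp add: adj_mat_def list_mat_def)

lemma adj_commute: "adj G x y = adj G y x"
  by (simp add: adj_def insert_commute)

lemma signed_graph_edgeD:
  assumes "signed_graph G" "{x, y} \<in> edges G"
  shows "x \<in> verts G" "y \<in> verts G" "x \<noteq> y"
  using assms by (force simp: signed_graph_def)+

lemma finite_verts: "signed_graph G \<Longrightarrow> finite (verts G)"
  by (simp add: signed_graph_def)

lemma adj_self: "signed_graph G \<Longrightarrow> adj G x x = 0"
  using signed_graph_edgeD(3)[of G x x] by (auto simp: adj_def)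

lemma induced_all_verts: "signed_graph G \<Longrightarrow> induced G (verts G) = G"
  by (intro sgraph.equality) (auto simp: induced_def signed_graph_def)

lemma verts_induced: "S \<subseteq> verts G \<Longrightarrow> verts (induced G S) = S"
  by (auto simp: induced_def)

lemma adj_induced: "x \<in> S \<Longrightarrow> y \<in> S \<Longrightarrow> adj (induced G S) x y = adj G x y"
  by (simp add: adj_def induced_def)

lemma graph_det_induced:
  assumes "distinct xs" "set xs \<subseteq> verts G"
  shows "graph_det (induced G (set xs)) = det (list_mat (adj G) xs)"
proof -
  have "graph_det (induced G (set xs)) = det (list_mat (adj (induced G (set xs))) xs)"
    using assms by (simp add: graph_det_eq verts_induced adj_mat_eq_list_mat)
  also have "list_mat (adj (induced G (set xs))) xs = list_mat (adj G) xs"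
    by (intro list_mat_cong) (simp add: adj_induced)
  finally show ?thesis .
qed

lemma graph_det_induced_cong:
  assumes "finite S" "S \<subseteq> verts G" "S \<subseteq> verts H"
    and "\<And>x y. x \<in> S \<Longrightarrow> y \<in> S \<Longrightarrow> adj G x y = adj H x y"
  shows "graph_det (induced G S) = graph_det (induced H S)"
proof -
  obtain xs where "distinct xs" "S = set xs"
    using finite_distinct_list[OF assms(1)] by blast
  moreover from this have "list_mat (adj G) xs = list_mat (adj H) xs"
    by (intro list_mat_cong) (auto intro: assms(4))
  ultimately show ?thesis
    using assms(2,3) by (simp add: graph_det_induced)
qed

lemma graph_det_disjoint_union:
  assumes "finite (verts G)" "A \<inter> B = {}" "A \<union> B \<subseteq> verts G"
    and "\<And>x y. x \<in> A \<Longrightarrow> y \<in> B \<Longrightarrow> adj G x y = 0"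
  shows "graph_det (induced G (A \<union> B)) = graph_det (induced G A) * graph_det (induced G B)"
proof -
  have "finite A" "finite B"
    using assms(1,3) by (auto intro: finite_subset)
  then obtain xs ys where "distinct xs" "A = set xs" "distinct ys" "B = set ys"
    using finite_distinct_list by metis
  then show ?thesis
    using assms(2-4) graph_det_induced[of "xs @ ys" G]
    by (simp add: graph_det_induced det_list_mat_append_upper_zero)
qed

lemma graph_det_cut_vertex:
  assumes "signed_graph G" "A \<inter> B = {}" "z \<notin> A \<union> B" "insert z (A \<union> B) \<subseteq> verts G"
    and no_edge: "\<And>x y. x \<in> A \<Longrightarrow> y \<in> B \<Longrightarrow> adj G x y = 0"
  shows "graph_det (induced G (insert z (A \<union> B))) =
    graph_det (induced G (insert z A)) * graph_det (induced G B) +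
    graph_det (induced G A) * graph_det (induced G (insert z B))"
proof -
  have "finite A" "finite B"
    using assms(4) finite_verts[OF assms(1)] by (auto intro: finite_subset)
  then obtain xs ys where lists: "distinct xs" "A = set xs" "distinct ys" "B = set ys"
    using finite_distinct_list by metis
  then have "det (list_mat (adj G) (xs @ z # ys)) =
      det (list_mat (adj G) (xs @ [z])) * det (list_mat (adj G) ys) +
      det (list_mat (adj G) xs) * det (list_mat (adj G) (z # ys))"
    using assms(2,3) no_edge no_edge[THEN adj_commute[THEN trans]]
    by (simp add: det_list_mat_cut_vertex adj_self[OF assms(1)])
  then show ?thesis
    using lists assms(2-4) graph_det_induced[of "xs @ z # ys" G] graph_det_induced[of "xs @ [z]" G]
      graph_det_induced[of "z # ys" G]
    by (simp add: graph_det_induced)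
qed

locale edge_join =
  fixes G :: "'a sgraph" and u :: 'a and H :: "'a sgraph" and w :: 'a and s :: int
  assumes signed_graph_left: "signed_graph G" and signed_graph_right: "signed_graph H"
    and verts_disjoint: "verts G \<inter> verts H = {}"
    and end_left: "u \<in> verts G" and end_right: "w \<in> verts H" and bridge_weight: "s \<in> {1, -1}"
begin

abbreviation J :: "'a sgraph" where
  "J \<equiv> join_edge G u H w s"

lemma signed_graph_join: "signed_graph J"
  by (rule signed_graph_join_edge)
     (fact signed_graph_left signed_graph_right verts_disjoint end_left end_right bridge_weight)+

lemma verts_join: "verts J = verts G \<union> verts H"
  by (simp add: join_edge_def)

lemma adj_join_left:
  assumes "x \<in> verts G" "y \<in> verts G"
  shows "adj J x y = adj G x y"
proof -
  have "{x, y} \<noteq> {u, w}" "{x, y} \<notin> edges H"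
    using assms verts_disjoint end_right signed_graph_edgeD(1)[OF signed_graph_right]
    by (auto simp: doubleton_eq_iff)
  then show ?thesis
    by (simp add: adj_def join_edge_def)
qed

lemma adj_join_right:
  assumes "x \<in> verts H" "y \<in> verts H"
  shows "adj J x y = adj H x y"
proof -
  have "{x, y} \<noteq> {u, w}" "{x, y} \<notin> edges G"
    using assms verts_disjoint end_left signed_graph_edgeD(1)[OF signed_graph_left]
    by (auto simp: doubleton_eq_iff)
  then show ?thesis
    by (simp add: adj_def join_edge_def)
qed

lemma adj_join_across:
  assumes "x \<in> verts G" "y \<in> verts H" "x \<noteq> u"
  shows "adj J x y = 0"
proof -
  have "{x, y} \<notin> edges G" "{x, y} \<notin> edges H" "{x, y} \<noteq> {u, w}"
    using assms verts_disjoint end_left signed_graph_edgeD(2)[OF signed_graph_left]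
      signed_graph_edgeD(1)[OF signed_graph_right]
    by (auto simp: doubleton_eq_iff)
  then show ?thesis
    by (simp add: adj_def join_edge_def)
qed

lemma graph_det_induced_left:
  assumes "S \<subseteq> verts G"
  shows "graph_det (induced J S) = graph_det (induced G S)"
proof (rule graph_det_induced_cong)
  show "finite S"
    using assms finite_verts[OF signed_graph_left] by (rule finite_subset)
  show "adj J x y = adj G x y" if "x \<in> S" "y \<in> S" for x y
    using that assms by (intro adj_join_left) auto
qed (use assms verts_join in auto)

lemma graph_det_induced_right: "graph_det (induced J (verts H)) = graph_det H"
proof -
  have "graph_det (induced J (verts H)) = graph_det (induced H (verts H))"
    by (rule graph_det_induced_cong)
       (auto simp: finite_verts signed_graph_right verts_join adj_join_right)
  then show ?thesis
    by (simp add: induced_all_verts signed_graph_right)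
qed

lemma graph_det_delete_right: "graph_det (delete J (verts H)) = graph_det G"
proof -
  have "verts J - verts H = verts G"
    using verts_disjoint verts_join by auto
  then show ?thesis
    by (simp add: delete_def graph_det_induced_left induced_all_verts signed_graph_left)
qed

lemma graph_det_induced_join:
  assumes "u \<in> S" "S \<subseteq> verts G"
  shows "graph_det (induced J (S \<union> verts H)) =
    graph_det (induced G S) * graph_det H +
    graph_det (induced G (S - {u})) * graph_det (induced J (insert u (verts H)))"
proof -
  have "insert u (S - {u} \<union> verts H) = S \<union> verts H"
    using assms(1) by auto
  moreover have "graph_det (induced J (insert u (S - {u} \<union> verts H))) =
      graph_det (induced J (insert u (S - {u}))) * graph_det (induced J (verts H)) +
      graph_det (induced J (S - {u})) * graph_det (induced J (insert u (verts H)))"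
  proof (rule graph_det_cut_vertex[OF signed_graph_join])
    show "adj J x y = 0" if "x \<in> S - {u}" "y \<in> verts H" for x y
      using that assms(2) by (intro adj_join_across) auto
  qed (use assms end_left verts_disjoint verts_join in auto)
  moreover have "S - {u} \<subseteq> verts G"
    using assms(2) by auto
  ultimately show ?thesis
    using assms by (simp add: insert_absorb graph_det_induced_left graph_det_induced_right)
qed

lemma graph_det_join:
  "graph_det J =
    graph_det G * graph_det H +
    graph_det (delete G {u}) * graph_det (induced J (insert u (verts H)))"
  using graph_det_induced_join[OF end_left order_refl] induced_all_verts[OF signed_graph_join]
  by (simp add: verts_join delete_def induced_all_verts signed_graph_left)

end

lemma graph_det_join_edge_twice:
  fixes G H1 H2 :: "'a sgraph" and a b w1 w2 :: 'a and s1 s2 :: int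
  defines "W \<equiv> join_edge G b H2 w2 s2"
  defines "U \<equiv> join_edge W a H1 w1 s1"
  assumes inner: "edge_join G b H2 w2 s2" and outer: "edge_join W a H1 w1 s1"
    and ends: "a \<in> verts G" "a \<noteq> b"
  shows "graph_det U =
      graph_det (delete U (verts H1)) * graph_det H1
    + graph_det (induced U (insert a (verts H1))) * graph_det (induced U (insert b (verts H2)))
        * graph_det (delete G {a, b})
    + graph_det (induced U (insert a (verts H1))) * graph_det H2 * graph_det (delete G {a})"
proof -
  interpret W: edge_join G b H2 w2 s2
    rewrites "join_edge G b H2 w2 s2 = W"
    by (simp_all add: inner W_def)
  interpret U: edge_join W a H1 w1 s1
    rewrites "join_edge W a H1 w1 s1 = U"
    by (simp_all add: outer U_def)
  have "graph_det U = graph_det W * graph_det H1 +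
      graph_det (delete W {a}) * graph_det (induced U (insert a (verts H1)))"
    by (rule U.graph_det_join)
  also have "graph_det W = graph_det (delete U (verts H1))"
    by (rule U.graph_det_delete_right[symmetric])
  also have "delete W {a} = induced W ((verts G - {a}) \<union> verts H2)"
    unfolding delete_def W.verts_join
    by (rule arg_cong[of _ _ "induced W"]) (use ends(1) W.verts_disjoint in auto)
  also have "graph_det \<dots> = graph_det (induced G (verts G - {a})) * graph_det H2 +
      graph_det (induced G (verts G - {a} - {b})) * graph_det (induced W (insert b (verts H2)))"
    using ends W.end_left by (intro W.graph_det_induced_join) auto
  also have "induced G (verts G - {a}) = delete G {a}"
    by (simp add: delete_def)
  also have "induced G (verts G - {a} - {b}) = delete G {a, b}"
    by (simp add: delete_def Diff_insert2[symmetric] insert_commute)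
  also have "graph_det (induced W (insert b (verts H2))) =
      graph_det (induced U (insert b (verts H2)))"
    by (rule U.graph_det_induced_left[symmetric]) (use W.end_left W.verts_join in auto)
  finally show ?thesis
    by (simp add: algebra_simps)
qed

lemma signed_cycle_vertex_eq_iff:
  assumes "signed_cycle C n v" "i \<in> {1..n}" "j \<in> {1..n}"
  shows "v i = v j \<longleftrightarrow> i = j"
  using assms by (auto simp: signed_cycle_def inj_on_eq_iff)

lemma signed_cycle_edge_iff:
  assumes cycle: "signed_cycle C n v" and range: "i \<in> {1..n}" "j \<in> {1..n}"
  shows "{v i, v j} \<in> edges C \<longleftrightarrow> j = i + 1 \<or> i = j + 1 \<or> {i, j} = {1, n}"
proof -
  have pair_eq: "{v i, v j} = {v k, v m} \<longleftrightarrow> {i, j} = {k, m}"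
    if "k \<in> {1..n}" "m \<in> {1..n}" for k m
    using range that by (simp add: doubleton_eq_iff signed_cycle_vertex_eq_iff[OF cycle])
  have "{v i, v j} \<in> edges C \<longleftrightarrow>
      (\<exists>k. (1 \<le> k \<and> k < n) \<and> {v i, v j} = {v k, v (k + 1)}) \<or> {v i, v j} = {v n, v 1}"
    using cycle by (simp add: signed_cycle_def) blast
  also have "\<dots> \<longleftrightarrow> (\<exists>k. (1 \<le> k \<and> k < n) \<and> {i, j} = {k, k + 1}) \<or> {i, j} = {n, 1}"
    using range by (intro arg_cong2[of _ _ _ _ "(\<or>)"] ex_cong1 conj_cong refl pair_eq) auto
  also have "\<dots> \<longleftrightarrow> j = i + 1 \<or> i = j + 1 \<or> {i, j} = {1, n}"
    using range by (auto simp: doubleton_eq_iff)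
  finally show ?thesis .
qed

lemma graph_det_signed_cycle_delete_two:
  assumes cycle: "signed_cycle C n v" and bounds: "1 \<le> i" "i < j" "j \<le> n"
  shows "graph_det (delete C {v i, v j}) =
    graph_det (induced C (v ` {i<..<j})) * graph_det (induced C (v ` ({1..<i} \<union> {j<..n})))"
proof -
  let ?inner = "{i<..<j}" and ?outer = "{1..<i} \<union> {j<..n}"
  have inj: "inj_on v {1..n}" and verts: "verts C = v ` {1..n}"
    using cycle by (auto simp: signed_cycle_def)
  have "verts C - {v i, v j} = v ` ({1..n} - {i, j})"
    using bounds by (simp add: verts inj_on_image_set_diff[OF inj])
  also have "{1..n} - {i, j} = ?inner \<union> ?outer"
    using bounds by auto
  finally have "delete C {v i, v j} = induced C (v ` ?inner \<union> v ` ?outer)"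
    by (simp add: delete_def image_Un)
  also have "graph_det \<dots> = graph_det (induced C (v ` ?inner)) * graph_det (induced C (v ` ?outer))"
  proof (rule graph_det_disjoint_union)
    show "finite (verts C)"
      by (simp add: verts)
    show "v ` ?inner \<inter> v ` ?outer = {}"
      using bounds by (subst inj_on_image_Int[OF inj, symmetric]) auto
    show "v ` ?inner \<union> v ` ?outer \<subseteq> verts C"
      using bounds by (auto simp: verts)
    show "adj C x y = 0" if arcs: "x \<in> v ` ?inner" "y \<in> v ` ?outer" for x y
    proof -
      obtain k m where "x = v k" "k \<in> ?inner" "y = v m" "m \<in> ?outer"
        using arcs by blast
      then show ?thesis
        using bounds by (auto simp: adj_def signed_cycle_edge_iff[OF cycle] doubleton_eq_iff)
    qed
  qed
  finally show ?thesis .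
qed

theorem theorem10:
  fixes C T1 T2 U :: "'a sgraph" and v :: "nat \<Rightarrow> 'a" and r1 r2 :: 'a
    and s1 s2 :: int and n l m1 m2 :: nat
  assumes "signed_cycle C n v"
    and "signed_tree T1" and "card (verts T1) = m1" and "r1 \<in> verts T1"
    and "signed_tree T2" and "card (verts T2) = m2" and "r2 \<in> verts T2"
    and "verts T1 \<inter> verts T2 = {}"
    and "verts C \<inter> verts T1 = {}" and "verts C \<inter> verts T2 = {}"
    and "s1 \<in> {1, -1}" and "s2 \<in> {1, -1}"
    and "1 \<le> l" and "l + 1 \<le> n" and "graph_dist C (v 1) (v (l + 1)) = l"
    and "U = unicyclic C v l T1 r1 s1 T2 r2 s2"
  shows "graph_det U =
      graph_det (delete U (verts T1)) * graph_det T1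
    + graph_det (induced U (verts T1 \<union> {v 1})) * graph_det (induced U (verts T2 \<union> {v (l + 1)}))
        * graph_det (induced C (v ` {2..l})) * graph_det (induced C (v ` {l + 2..n}))
    + graph_det (induced U (verts T1 \<union> {v 1})) * graph_det T2 * graph_det (delete C {v 1})"
proof -
  have graphs: "signed_graph C" "signed_graph T1" "signed_graph T2"
    using assms(1,2,5) by (auto simp: signed_cycle_def signed_tree_def)
  have ends: "v 1 \<in> verts C" "v (l + 1) \<in> verts C" "v 1 \<noteq> v (l + 1)"
    using assms(1,13,14) signed_cycle_vertex_eq_iff[OF assms(1), of 1 "l + 1"]
    by (auto simp: signed_cycle_def)
  have T2_join: "edge_join C (v (l + 1)) T2 r2 s2"
    using graphs ends assms(7,10,12) by (intro edge_join.intro)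
  have T1_join: "edge_join (join_edge C (v (l + 1)) T2 r2 s2) (v 1) T1 r1 s1"
    using graphs ends assms(4,8,9,11) edge_join.signed_graph_join[OF T2_join]
      edge_join.verts_join[OF T2_join]
    by (intro edge_join.intro) auto
  have arcs: "{1<..<l + 1} = {2..l}" "{1..<1} \<union> {l + 1<..n} = {l + 2..n}"
    by auto
  have "graph_det (delete C {v 1, v (l + 1)}) =
      graph_det (induced C (v ` {2..l})) * graph_det (induced C (v ` {l + 2..n}))"
    using graph_det_signed_cycle_delete_two[OF assms(1), of 1 "l + 1", unfolded arcs] assms(13,14)
    by simp
  then show ?thesis
    using graph_det_join_edge_twice[OF T2_join T1_join ends(1,3)]
    by (simp add: assms(16) unicyclic_def mult.assoc)
qed

end
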